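(* Let $\alpha\in(0,1)$, $\sigma=1-\alpha/2$, $T>0$; let $\lambda\in\mathcal{C}^2[0,T]$ with $\lambda(t)>0$, $\lambda'(t)\le0$ on $[0,T]$; let $k,q$ be functions on $[0,1]\times[0,T]$ with $0<c_1\le k(x,t)\le c_2$ and $q(x,t)\ge0$; let $f$ be a function on $[0,1]\times[0,T]$ and $u_0$ a function on $[0,1]$. Let $h=1/N$, $\tau=T/M$ with $N\geq 2$, $M\ge1$ integers, $x_i=ih$, $t_j=j\tau$. Consider the difference scheme $$\Delta_{0t_{j+\sigma}}^{\alpha,\lambda(t)}y_i=\Lambda y_i^{(\sigma)}+\varphi_i^{j+\sigma},\quad i=1,\dots,N-1,\ j=0,1,\dots,M-1,$$ $$y_0^j=y_N^j=0\ (0\le j\le M),\qquad y_i^0=u_0(x_i)\ (0\le i\le N),$$ with all notation defined in the context. This scheme is unconditionally stable: for all such $N$ and $M$ (with no restriction relating $h$ and $\tau$) its solution satisfies, for every $j=0,1,\dots,M-1$, the a priori estimate $$\|y^{j+1}\|_0^2\le\|y^0\|_0^2+\frac{T^\alpha\,\Gamma(1-\alpha)}{2\lambda(T)c_1}\max_{0\le m\le M-1}\|\varphi^{m+\sigma}\|_0^2 .$$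
   Context: Notation: $y_i^j=y(x_i,t_j)$, $t_{j+\sigma}=(j+\sigma)\tau$, $y^{(\sigma)}=\sigma y^{j+1}+(1-\sigma)y^j$, $\varphi_i^{j+\sigma}=f(x_i,t_{j+\sigma})$, $\|y\|_0^2=\sum_{i=1}^{N-1}y_i^2h$. The spatial operator (at time level $j+\sigma$) is $$\Lambda y_i=\frac{a_{i+1}y_{i+1}-(a_{i+1}+a_i)y_i+a_iy_{i-1}}{h^2}-d_iy_i,$$ with $a_i=a_i^{j+\sigma}=k(x_{i}-h/2,t_{j+\sigma})$, $d_i=d_i^{j+\sigma}=q(x_i,t_{j+\sigma})$. The discrete fractional derivative is $$\Delta_{0t_{j+\sigma}}^{\alpha,\lambda(t)}y_i=\frac{\tau^{1-\alpha}}{\Gamma(2-\alpha)}\sum_{s=0}^{j}c_{j-s}^{(\alpha)}\,\frac{y_i^{s+1}-y_i^s}{\tau}.$$ Its coefficients are as follows. Write $\lambda_s=\lambda(s\tau)$ for real $s$, $$a_0^{(\alpha)}=\sigma^{1-\alpha},\qquad a_l^{(\alpha)}=(l+\sigma)^{1-\alpha}-(l-1+\sigma)^{1-\alpha}\quad(l\ge1),$$ $$b_l^{(\alpha)}=\tfrac{1}{2-\alpha}\left[(l+\sigma)^{2-\alpha}-(l-1+\sigma)^{2-\alpha}\right]-\tfrac12\left[(l+\sigma)^{1-\alpha}+(l-1+\sigma)^{1-\alpha}\right]\quad(l\ge1).$$ For $j=0$: $c_0^{(\alpha)}=\lambda_{\sigma-1/2}a_0^{(\alpha)}$. For $j\ge1$: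 $$c_s^{(\alpha)}=\begin{cases}\lambda_{\sigma-1/2}a_0^{(\alpha)}+\lambda_\sigma b_1^{(\alpha)}, & s=0,\\ \lambda_{s+\sigma-1/2}a_s^{(\alpha)}+\lambda_{s+\sigma}b_{s+1}^{(\alpha)}-\lambda_{s+\sigma}b_s^{(\alpha)}, & 1\le s\le j-1,\\ \lambda_{j+\sigma-1/2}a_j^{(\alpha)}-\lambda_{j+\sigma}b_j^{(\alpha)}, & s=j.\end{cases}$$ (The spatial coefficients $a_i,d_i$ are unrelated to $a_l^{(\alpha)},b_l^{(\alpha)}$.) *)

theory Defs
  imports "HOL-Analysis.Analysis"
begin

text \<open>Derivatives are taken within the interval, hence one-sided at the end points.\<close>

definition C2_on :: "real \<Rightarrow> real \<Rightarrow> (real \<Rightarrow> real) \<Rightarrow> bool" where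
  "C2_on a b g \<longleftrightarrow> (\<exists>g' g''.
      (\<forall>t\<in>{a..b}. (g has_real_derivative g' t) (at t within {a..b})) \<and>
      (\<forall>t\<in>{a..b}. (g' has_real_derivative g'' t) (at t within {a..b})) \<and>
      continuous_on {a..b} g'')"

text \<open>Shared parameters: \<open>al\<close> is the fractional order $\alpha$, \<open>sg\<close> the shift $\sigma$,
  \<open>lam\<close> the function $\lambda$, \<open>h\<close> and \<open>tau\<close> the mesh widths. A grid function in space is
  \<open>v i\<close>; a grid function in space and time is \<open>y j i\<close>, with the time level \<open>j\<close> first.\<close>

definition frac_a :: "real \<Rightarrow> real \<Rightarrow> nat \<Rightarrow> real" where
  "frac_a al sg l =
     (if l = 0 then sg powr (1 - al)
      else (real l + sg) powr (1 - al) - (real l - 1 + sg) powr (1 - al))"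

text \<open>Only used for $l \ge 1$.\<close>

definition frac_b :: "real \<Rightarrow> real \<Rightarrow> nat \<Rightarrow> real" where
  "frac_b al sg l =
     1 / (2 - al) * ((real l + sg) powr (2 - al) - (real l - 1 + sg) powr (2 - al))
     - 1 / 2 * ((real l + sg) powr (1 - al) + (real l - 1 + sg) powr (1 - al))"

text \<open>The coefficient $c_s^{(\alpha)}$ depends on the time level \<open>j\<close>; it is only used for
  $0 \le s \le j$. In the source, $\lambda_r$ for real $r$ means $\lambda(r\tau)$.\<close>

definition frac_c ::
  "real \<Rightarrow> real \<Rightarrow> (real \<Rightarrow> real) \<Rightarrow> real \<Rightarrow> nat \<Rightarrow> nat \<Rightarrow> real" where
  "frac_c al sg lam tau j s =
     (if j = 0 then lam ((sg - 1/2) * tau) * frac_a al sg 0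
      else if s = 0 then
        lam ((sg - 1/2) * tau) * frac_a al sg 0 + lam (sg * tau) * frac_b al sg 1
      else if s < j then
        lam ((real s + sg - 1/2) * tau) * frac_a al sg s
        + lam ((real s + sg) * tau) * frac_b al sg (s + 1)
        - lam ((real s + sg) * tau) * frac_b al sg s
      else
        lam ((real j + sg - 1/2) * tau) * frac_a al sg j
        - lam ((real j + sg) * tau) * frac_b al sg j)"

text \<open>\<open>w s\<close> is the value of the time grid function at $t_s$.\<close>

definition frac_deriv ::
  "real \<Rightarrow> real \<Rightarrow> (real \<Rightarrow> real) \<Rightarrow> real \<Rightarrow> nat \<Rightarrow> (nat \<Rightarrow> real) \<Rightarrow> real" where
  "frac_deriv al sg lam tau j w =
     tau powr (1 - al) / Gamma (2 - al)
     * (\<Sum>s=0..j. frac_c al sg lam tau j (j - s) * ((w (s + 1) - w s) / tau))"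

text \<open>The spatial operator $\Lambda$ at time \<open>t\<close>, at an interior node \<open>i\<close> $\ge 1$.
  Here $a_i = k(x_i - h/2, t)$, $a_{i+1} = k(x_{i+1} - h/2, t)$, $d_i = q(x_i, t)$.\<close>

definition space_op ::
  "(real \<Rightarrow> real \<Rightarrow> real) \<Rightarrow> (real \<Rightarrow> real \<Rightarrow> real) \<Rightarrow> real \<Rightarrow> real \<Rightarrow>
   (nat \<Rightarrow> real) \<Rightarrow> nat \<Rightarrow> real" where
  "space_op k q h t v i =
     (let a = (\<lambda>m::nat. k (real m * h - h / 2) t)
      in (a (i + 1) * v (i + 1) - (a (i + 1) + a i) * v i + a i * v (i - 1)) / h\<^sup>2
         - q (real i * h) t * v i)"

definition shifted :: "real \<Rightarrow> (nat \<Rightarrow> nat \<Rightarrow> real) \<Rightarrow> nat \<Rightarrow> nat \<Rightarrow> real" where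
  "shifted sg y j i = sg * y (j + 1) i + (1 - sg) * y j i"

definition source_grid ::
  "(real \<Rightarrow> real \<Rightarrow> real) \<Rightarrow> real \<Rightarrow> real \<Rightarrow> real \<Rightarrow> nat \<Rightarrow> nat \<Rightarrow> real" where
  "source_grid f sg h tau j i = f (real i * h) ((real j + sg) * tau)"

text \<open>The square $\|v\|_0^2$ of the discrete $L_2$ norm on a grid with \<open>N\<close> cells.\<close>

definition norm0_sq :: "nat \<Rightarrow> real \<Rightarrow> (nat \<Rightarrow> real) \<Rightarrow> real" where
  "norm0_sq N h v = (\<Sum>i=1..N-1. (v i)\<^sup>2 * h)"

definition solves_scheme ::
  "real \<Rightarrow> real \<Rightarrow> (real \<Rightarrow> real) \<Rightarrow> (real \<Rightarrow> real \<Rightarrow> real) \<Rightarrow> (real \<Rightarrow> real \<Rightarrow> real) \<Rightarrow>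
   (real \<Rightarrow> real \<Rightarrow> real) \<Rightarrow> (real \<Rightarrow> real) \<Rightarrow> nat \<Rightarrow> nat \<Rightarrow> real \<Rightarrow> real \<Rightarrow>
   (nat \<Rightarrow> nat \<Rightarrow> real) \<Rightarrow> bool" where
  "solves_scheme al sg lam k q f u0 N M h tau y \<longleftrightarrow>
     (\<forall>i\<in>{1..N-1}. \<forall>j<M.
        frac_deriv al sg lam tau j (\<lambda>s. y s i)
        = space_op k q h ((real j + sg) * tau) (shifted sg y j) i
          + source_grid f sg h tau j i) \<and>
     (\<forall>j\<le>M. y j 0 = 0 \<and> y j N = 0) \<and>
     (\<forall>i\<le>N. y 0 i = u0 (real i * h))"

end

theory Submission
  imports Defs
begin

text \<open>Up to the factor $1-\alpha$, the coefficients $a_l$ and $b_l$ are the integrals of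
  $x^{-\alpha}$ against the weights $1$ and $m - x$ over the unit interval with midpoint
  $m = l - 1/2 + \sigma$, which makes $a_l - b_l$ and $b_l$ nonincreasing in
  $l$, nonnegative, and gives $a_l - b_l \ge (1-\alpha)(l+\sigma)^{-\alpha}$. As $\lambda$ is
  nonincreasing, the $c_s$ are then positive and nonincreasing in $s$, whatever the mesh widths, and
  $(2\sigma-1) c_0 \ge \sigma c_1$. By Abel summation this yields
  $\Delta (y^2) \le 2 y^{(\sigma)} \Delta y$. Multiplying the scheme by $y^{(\sigma)}$ and absorbing
  the source by the coercivity of $\Lambda$ bounds $\Delta \|y\|_0^2$ by $\|\varphi\|_0^2/(2c_1)$;
  the estimate follows by induction on the time level from the lower bound for $c_j$.\<close>

section \<open>Coefficients of the discrete fractional derivative\<close>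

text \<open>The hypothesis fixes the sign of the second derivative. The factor \<open>c\<close>
  covers both later uses: the negated concave power \<open>z powr p\<close> and its convex
  derivative \<open>p * z powr (p - 1)\<close>.\<close>

lemma convex_on_scaled_powr:
  fixes c r :: real
  assumes "c * r * (r - 1) \<ge> 0"
  shows "convex_on {0<..} (\<lambda>x. c * x powr r)"
proof (rule f''_ge0_imp_convex)
  show "((\<lambda>x. c * x powr r) has_real_derivative c * (r * x powr (r - 1))) (at x)"
    if "x \<in> {0<..}" for x :: real
    using that by (auto intro!: derivative_eq_intros)
  show "((\<lambda>x. c * (r * x powr (r - 1))) has_real_derivative
          c * r * (r - 1) * x powr (r - 2)) (at x)"
    if "x \<in> {0<..}" for x :: real
    using that by (auto intro!: derivative_eq_intros)
qed (use assms in auto)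

text \<open>The upper half of the Hermite-Hadamard inequality, phrased with an antiderivative
  \<open>G\<close> instead of an integral: subtracting from \<open>G\<close> an antiderivative of
  the chord of \<open>g\<close> leaves a function with nonpositive derivative.\<close>

lemma convex_increment_le_trapezoid:
  fixes G g :: "real \<Rightarrow> real"
  assumes G: "\<And>z. z \<in> {x..x+1} \<Longrightarrow> (G has_real_derivative g z) (at z)"
    and g: "convex_on {x..x+1} g"
  shows "G (x + 1) - G x \<le> (g x + g (x + 1)) / 2"
proof -
  define H where "H z = G z - (g x * z + (g (x + 1) - g x) * (z - x)\<^sup>2 / 2)" for z
  have "H (x + 1) \<le> H x"
  proof (rule DERIV_nonpos_imp_nonincreasing[of x "x + 1" H])
    fix z assume "x \<le> z" "z \<le> x + 1"
    then have z: "z \<in> {x..x+1}" by simp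
    have "(H has_real_derivative g z - (g x + (g (x + 1) - g x) * (z - x))) (at z)"
      unfolding H_def using G[OF z] by (auto intro!: derivative_eq_intros)
    moreover have "g z \<le> g x + (g (x + 1) - g x) * (z - x)"
      using convex_onD_Icc'[OF g z] by simp
    ultimately show "\<exists>D. (H has_real_derivative D) (at z) \<and> D \<le> 0"
      by force
  qed simp
  then have "G (x + 1) - G x \<le> g x + (g (x + 1) - g x) / 2"
    by (simp add: H_def distrib_left)
  then show ?thesis by (simp add: field_simps)
qed

text \<open>This is weighted AM-GM, x^p z^(1-p) <= p x + (1-p) z, multiplied by z^(p-1).\<close>

lemma powr_le_tangent:
  fixes x z p :: real
  assumes "0 < x" "0 < z" "0 < p" "p < 1"
  shows "x powr p \<le> z powr p + p * z powr (p - 1) * (x - z)"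
proof -
  have "x powr p * z powr (1 - p) \<le> p * x + (1 - p) * z"
    using assms by (intro Youngs_inequality_0) auto
  then have "x powr p * z powr (1 - p) * z powr (p - 1) \<le> (p * x + (1 - p) * z) * z powr (p - 1)"
    by (intro mult_right_mono) auto
  moreover have "z powr (1 - p) * z powr (p - 1) = 1"
    using assms by (simp flip: powr_add)
  moreover have "z * z powr (p - 1) = z powr p"
    using assms by (simp add: powr_mult_base)
  ultimately show ?thesis
    by (simp add: algebra_simps)
qed

text \<open>The error of the trapezoidal rule for \<open>z powr p\<close> on \<open>{x..x+1}\<close>.\<close>

definition powr_defect :: "real \<Rightarrow> real \<Rightarrow> real" where
  "powr_defect p x = ((x + 1) powr (p + 1) - x powr (p + 1)) / (p + 1)
     - ((x + 1) powr p + x powr p) / 2"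

text \<open>The trapezoidal rule underestimates the integral of a concave function; the convex
  estimate is applied to the negated power.\<close>

lemma powr_defect_nonneg:
  assumes "0 < p" "p < 1" "0 < x"
  shows "powr_defect p x \<ge> 0"
proof -
  have cvx: "convex_on {x..x+1} (\<lambda>z. (-1) * z powr p)"
    using assms by (intro convex_on_subset[OF convex_on_scaled_powr]) (auto simp: mult_le_0_iff)
  have deriv: "((\<lambda>z. - (z powr (p + 1) / (p + 1))) has_real_derivative (-1) * z powr p) (at z)"
    if "z \<in> {x..x+1}" for z
    using assms that by (auto intro!: derivative_eq_intros)
  have "- ((x+1) powr (p + 1) / (p + 1)) - - (x powr (p + 1) / (p + 1))
      \<le> ((-1) * x powr p + (-1) * (x + 1) powr p) / 2"
    using convex_increment_le_trapezoid[OF deriv cvx] .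
  then show ?thesis
    unfolding powr_defect_def diff_divide_distrib add_divide_distrib by linarith
qed

lemma powr_defect_has_derivative:
  assumes "0 < p" "0 < x"
  shows "(powr_defect p has_real_derivative
    (x + 1) powr p - x powr p - p * ((x + 1) powr (p - 1) + x powr (p - 1)) / 2) (at x)"
proof -
  have "(powr_defect p has_real_derivative
      ((p + 1) * (x + 1) powr p - (p + 1) * x powr p) / (p + 1)
      - (p * (x + 1) powr (p - 1) + p * x powr (p - 1)) / 2) (at x)"
    unfolding powr_defect_def using assms by (auto intro!: derivative_eq_intros)
  moreover have "((p + 1) * (x + 1) powr p - (p + 1) * x powr p) / (p + 1) = (x + 1) powr p - x powr p"
    using assms by (simp flip: right_diff_distrib)
  ultimately show ?thesis
    by (simp add: distrib_left)
qed

text \<open>The derivative of the defect is the increment of z^p minus the trapezoidal value for its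
  convex derivative, hence nonpositive.\<close>

lemma powr_defect_antimono:
  assumes "0 < p" "p < 1" "0 < x" "x \<le> y"
  shows "powr_defect p y \<le> powr_defect p x"
proof (rule DERIV_nonpos_imp_nonincreasing[OF \<open>x \<le> y\<close>])
  fix z assume "x \<le> z" "z \<le> y"
  with assms have z: "0 < z" by simp
  have cvx: "convex_on {z..z+1} (\<lambda>s. p * s powr (p - 1))"
    using assms z
    by (intro convex_on_subset[OF convex_on_scaled_powr]) (auto simp: mult_nonpos_nonpos mult_nonneg_nonpos)
  have deriv: "((\<lambda>s. s powr p) has_real_derivative p * s powr (p - 1)) (at s)"
    if "s \<in> {z..z+1}" for s
    using z that by (auto intro!: derivative_eq_intros)
  have "(z + 1) powr p - z powr p \<le> (p * z powr (p - 1) + p * (z + 1) powr (p - 1)) / 2"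
    using convex_increment_le_trapezoid[OF deriv cvx] .
  then have "(z + 1) powr p - z powr p - p * ((z + 1) powr (p - 1) + z powr (p - 1)) / 2 \<le> 0"
    by (simp add: distrib_left add.commute)
  then show "\<exists>D. (powr_defect p has_real_derivative D) (at z) \<and> D \<le> 0"
    using powr_defect_has_derivative[OF \<open>0 < p\<close> z] by blast
qed

text \<open>With a and b the slopes of z^p at the right and left end of the unit interval and c its
  increment, the derivative is a - b - (c - (a + b) / 2), which is nonpositive because a <= b and a
  <= c.\<close>

lemma powr_increment_minus_defect_antimono:
  assumes "0 < p" "p < 1" "0 < x" "x \<le> y"
  shows "(y + 1) powr p - y powr p - powr_defect p y \<le> (x + 1) powr p - x powr p - powr_defect p x"
proof (rule DERIV_nonpos_imp_nonincreasing[OF \<open>x \<le> y\<close>])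
  fix z assume "x \<le> z" "z \<le> y"
  with assms have z: "0 < z" by simp
  let ?D = "p * (z + 1) powr (p - 1) - p * z powr (p - 1) -
    ((z + 1) powr p - z powr p - p * ((z + 1) powr (p - 1) + z powr (p - 1)) / 2)"
  have "((\<lambda>z. (z + 1) powr p - z powr p - powr_defect p z) has_real_derivative ?D) (at z)"
    using powr_defect_has_derivative[OF \<open>0 < p\<close> z] z by (auto intro!: derivative_eq_intros)
  moreover have "(z + 1) powr p - z powr p \<ge> p * (z + 1) powr (p - 1)"
    using powr_le_tangent[of z "z + 1" p] assms z by simp
  moreover have "p * (z + 1) powr (p - 1) \<le> p * z powr (p - 1)"
    using assms z by (intro mult_left_mono powr_mono2') auto
  moreover have "?D \<le> 0"
  proof -
    have "a - b - (c - (a + b) / 2) \<le> 0" if "a \<le> b" "a \<le> c" for a b c :: real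
      using that by (simp add: field_simps)
    from this[OF calculation(3,2)] show ?thesis by (simp only: distrib_left)
  qed
  ultimately show "\<exists>D. ((\<lambda>z. (z + 1) powr p - z powr p - powr_defect p z)
      has_real_derivative D) (at z) \<and> D \<le> 0"
    by blast
qed

text \<open>Below its tangent at the right end, of slope \<open>r\<close>, the power has integral at
  most \<open>(x + 1) powr p - r / 2\<close>, which yields one half of \<open>r\<close>; the same
  tangent evaluated at \<open>x\<close> yields the other half.\<close>

lemma powr_increment_minus_defect_ge:
  assumes "0 < p" "p < 1" "0 < x"
  shows "p * (x + 1) powr (p - 1) \<le> (x + 1) powr p - x powr p - powr_defect p x"
proof -
  define r where "r = p * (x + 1) powr (p - 1)"
  define H where "H z = z powr (p + 1) / (p + 1) - ((x + 1) powr p * z + r * (z - (x + 1))\<^sup>2 / 2)" for z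
  have "H (x + 1) \<le> H x"
  proof (rule DERIV_nonpos_imp_nonincreasing[of x "x + 1" H])
    fix z assume "x \<le> z" "z \<le> x + 1"
    with assms have z: "0 < z" by simp
    have "(H has_real_derivative z powr p - ((x + 1) powr p + r * (z - (x + 1)))) (at z)"
      unfolding H_def using assms z by (auto intro!: derivative_eq_intros)
    moreover have "z powr p \<le> (x + 1) powr p + r * (z - (x + 1))"
      unfolding r_def using assms z by (intro powr_le_tangent) auto
    ultimately show "\<exists>D. (H has_real_derivative D) (at z) \<and> D \<le> 0"
      by force
  qed simp
  moreover have "x powr p \<le> (x + 1) powr p - r"
    using powr_le_tangent[of x "x + 1" p] assms by (simp add: r_def)
  ultimately show ?thesis
    unfolding r_def[symmetric] powr_defect_def H_def diff_divide_distrib add_divide_distrib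
    by (simp add: algebra_simps)
qed

section \<open>The coefficients a_l and b_l\<close>

text \<open>The dictionary for the facts below: p = 1 - \<alpha> on the unit interval from l - 1 +
  \<sigma> to l + \<sigma>.\<close>

lemma frac_b_eq_defect:
  assumes "0 < al" "al < 1" "l \<ge> 1"
  shows "frac_b al sg l = powr_defect (1 - al) (real l - 1 + sg)"
proof -
  have eqs: "1 - al + 1 = 2 - al" "real l - 1 + sg + 1 = real l + sg"
    by simp_all
  show ?thesis unfolding frac_b_def powr_defect_def eqs by simp
qed

lemma frac_a_eq_increment:
  assumes "l \<ge> 1"
  shows "frac_a al sg l = (real l - 1 + sg + 1) powr (1 - al) - (real l - 1 + sg) powr (1 - al)"
proof -
  have eqs: "real l - 1 + sg + 1 = real l + sg"
    by simp
  show ?thesis using assms unfolding frac_a_def eqs by simp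
qed

lemma frac_b_nonneg:
  assumes "0 < al" "al < 1" "0 < sg" "l \<ge> 1"
  shows "frac_b al sg l \<ge> 0"
  using assms by (simp add: frac_b_eq_defect powr_defect_nonneg)

lemma frac_b_Suc_le:
  assumes "0 < al" "al < 1" "0 < sg" "l \<ge> 1"
  shows "frac_b al sg (Suc l) \<le> frac_b al sg l"
  using assms by (simp add: frac_b_eq_defect powr_defect_antimono)

lemma frac_a_minus_b_Suc_le:
  assumes "0 < al" "al < 1" "0 < sg" "l \<ge> 1"
  shows "frac_a al sg (Suc l) - frac_b al sg (Suc l) \<le> frac_a al sg l - frac_b al sg l"
proof -
  have "0 < 1 - al" "1 - al < 1" "0 < real l - 1 + sg" "real l - 1 + sg \<le> real (Suc l) - 1 + sg"
    using assms by simp_all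
  from powr_increment_minus_defect_antimono[OF this] show ?thesis
    using assms by (simp only: frac_b_eq_defect frac_a_eq_increment)
qed

lemma frac_a_minus_b_ge:
  assumes "0 < al" "al < 1" "0 < sg" "l \<ge> 1"
  shows "(1 - al) * (real l + sg) powr (- al) \<le> frac_a al sg l - frac_b al sg l"
proof -
  have "0 < 1 - al" "1 - al < 1" "0 < real l - 1 + sg"
    and eqs: "1 - al - 1 = - al" "real l + sg = real l - 1 + sg + 1"
    using assms by simp_all
  from powr_increment_minus_defect_ge[OF this(1-3)] show ?thesis
    using assms unfolding eqs by (simp only: frac_b_eq_defect frac_a_eq_increment)
qed

text \<open>Since $2 - \alpha = 2\sigma$, the right-hand side collapses to a multiple of
  $(1+\sigma)^{1-\alpha}$; Bernoulli's inequality then reduces the claim to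
  $(1-\sigma)(2\sigma-1)^2 \ge 0$.\<close>

lemma frac_a_1_le:
  assumes "0 < al" "al < 1" "sg = 1 - al / 2"
  shows "sg * frac_a al sg 1 \<le> (1 - al) * (frac_a al sg 0 + frac_b al sg 1)"
proof -
  define p where "p = 1 - al"
  have p: "0 < p" "p < 1" "p = 2 * sg - 1" and sg: "1/2 < sg" "sg < 1"
    using assms by (auto simp: p_def)
  define A where "A = sg powr p"
  define B where "B = (1 + sg) powr p"
  have A: "A > 0" using sg by (simp add: A_def)
  have "((1 + sg) / sg) powr p * 1 powr (1 - p) \<le> p * ((1 + sg) / sg) + (1 - p) * 1"
    using p sg by (intro Youngs_inequality_0) auto
  moreover have "p * ((1 + sg) / sg) + (1 - p) * 1 = (3 * sg - 1) / sg"
    using sg by (simp add: p(3) field_simps)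
  ultimately have "B / A \<le> (3 * sg - 1) / sg"
    using sg by (simp add: A_def B_def powr_divide)
  then have B: "B * sg \<le> (3 * sg - 1) * A"
    using A sg by (simp add: field_simps)
  have "(1 + sg) powr (p + 1) = (1 + sg) * B" "sg powr (p + 1) = sg * A"
    using sg by (simp_all add: A_def B_def powr_add)
  then have "frac_b al sg 1 = 1 / (2 * sg) * ((1 + sg) * B - sg * A) - 1 / 2 * (B + A)"
    using assms p by (simp add: frac_b_def A_def B_def p_def add.commute)
  also have "\<dots> = B / (2 * sg) - A"
    using sg by (simp add: field_simps)
  finally have b: "frac_a al sg 0 + frac_b al sg 1 = B / (2 * sg)"
    by (simp add: frac_a_def A_def p_def)
  have a: "frac_a al sg 1 = B - A"
    by (simp add: frac_a_def A_def B_def p_def)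
  \<comment> \<open>Clearing denominators in the goal leaves
    \<open>(2 * sg\<^sup>2 - 2 * sg + 1) * B \<le> 2 * sg\<^sup>2 * A\<close>, so the Bernoulli
    bound is scaled by this factor.\<close>
  have "(2 * sg\<^sup>2 - 2 * sg + 1) * (B * sg) \<le> (2 * sg\<^sup>2 - 2 * sg + 1) * ((3 * sg - 1) * A)"
  proof (rule mult_left_mono[OF B])
    have "0 \<le> sg\<^sup>2 + (1 - sg)\<^sup>2" by simp
    then show "0 \<le> 2 * sg\<^sup>2 - 2 * sg + 1"
      by (simp add: power2_eq_square algebra_simps)
  qed
  also have "\<dots> = (2 * sg\<^sup>2 * A) * sg - (1 - sg) * (2 * sg - 1)\<^sup>2 * A"
    by (simp add: power2_eq_square algebra_simps)
  also have "\<dots> \<le> (2 * sg\<^sup>2 * A) * sg"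
    using sg A by simp
  finally have "(2 * sg\<^sup>2 - 2 * sg + 1) * B * sg \<le> (2 * sg\<^sup>2 * A) * sg"
    by (simp only: mult.assoc)
  then have "(2 * sg\<^sup>2 - 2 * sg + 1) * B \<le> 2 * sg\<^sup>2 * A"
    using sg by (simp only: mult_le_cancel_right_pos)
  then have "sg * (B - A) * (2 * sg) \<le> (2 * sg - 1) * B"
    by (simp add: algebra_simps power2_eq_square)
  then have "sg * (B - A) \<le> (2 * sg - 1) * (B / (2 * sg))"
    using sg by (simp only: times_divide_eq_right) (subst pos_le_divide_eq, auto)
  then show ?thesis
    unfolding a b p_def[symmetric] p(3) .
qed

section \<open>Positivity and monotonicity of the coefficients c_s\<close>

text \<open>\<open>T\<close> and \<open>tau\<close> are linked through the hypothesis
  \<open>(real j + sg) * tau \<le> T\<close> of the lemmas, which keeps every sample of \<lambda> at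
  level \<open>j\<close> inside [0, T].\<close>

locale nonincreasing_kernel =
  fixes al sg T tau :: real and lam :: "real \<Rightarrow> real"
  assumes al: "0 < al" "al < 1" and sg: "sg = 1 - al / 2" and tau: "0 < tau"
    and lam_pos: "\<And>t. t \<in> {0..T} \<Longrightarrow> lam t > 0"
    and lam_antimono: "\<And>s t. 0 \<le> s \<Longrightarrow> s \<le> t \<Longrightarrow> t \<le> T \<Longrightarrow> lam t \<le> lam s"
begin

lemma sg_bounds: "1 / 2 < sg" "sg < 1" "0 < sg" "1 - al \<le> sg" "2 * sg - 1 = 1 - al"
  using al by (auto simp: sg)

lemma lam_grid_pos:
  assumes "0 \<le> r" "r * tau \<le> T"
  shows "0 < lam (r * tau)"
  using assms tau by (intro lam_pos) auto

lemma lam_grid_le: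
  assumes "0 \<le> r" "r \<le> r'" "r' * tau \<le> T"
  shows "lam (r' * tau) \<le> lam (r * tau)"
  using assms tau by (intro lam_antimono) auto

lemma grid_le_T:
  assumes "r \<le> real j + sg" "(real j + sg) * tau \<le> T"
  shows "r * tau \<le> T"
  using assms tau by (meson mult_right_mono order_trans less_imp_le)

lemma frac_a_nonneg: "0 \<le> frac_a al sg l"
  using al sg_bounds by (auto simp: frac_a_def intro!: powr_mono2)

text \<open>The samples of \<lambda> are lowered to the later time
  \<open>(1 / 2 + sg) * tau\<close>, at which \<open>frac_c_le\<close> bounds c_1 from above, so
  that both coefficients can be compared with a common factor.\<close>

lemma frac_c_0_ge:
  assumes "1 \<le> j" "(real j + sg) * tau \<le> T"
  shows "lam ((1 / 2 + sg) * tau) * (frac_a al sg 0 + frac_b al sg 1) \<le> frac_c al sg lam tau j 0"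
proof -
  have T: "(1 / 2 + sg) * tau \<le> T"
    using assms by (intro grid_le_T[OF _ assms(2)]) auto
  have "lam ((1 / 2 + sg) * tau) * frac_a al sg 0 \<le> lam ((sg - 1 / 2) * tau) * frac_a al sg 0"
    using sg_bounds T by (intro mult_right_mono lam_grid_le frac_a_nonneg) auto
  moreover have "lam ((1 / 2 + sg) * tau) * frac_b al sg 1 \<le> lam (sg * tau) * frac_b al sg 1"
    using sg_bounds al T by (intro mult_right_mono lam_grid_le frac_b_nonneg) auto
  ultimately show ?thesis
    using assms(1) by (simp add: frac_c_def distrib_left)
qed

text \<open>The target sample is the one that bounds the next coefficient from above. As b_s enters
  with a minus sign, the factor of a_s is first lowered to that of b_s, and then the nonnegative a_s
  - b_s + b_(s+1) is treated as a whole.\<close>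

lemma frac_c_ge:
  assumes "1 \<le> s" "s < j" "(real j + sg) * tau \<le> T"
  shows "lam ((real s + 1 / 2 + sg) * tau) * (frac_a al sg s - frac_b al sg s + frac_b al sg (s + 1))
    \<le> frac_c al sg lam tau j s"
proof -
  define a b b' where "a = frac_a al sg s" and "b = frac_b al sg s" and "b' = frac_b al sg (s + 1)"
  define L where "L r = lam ((real s + r + sg) * tau)" for r
  have T: "(real s + r + sg) * tau \<le> T" if "r \<le> 1 / 2" for r
    using assms that by (intro grid_le_T[OF _ assms(3)]) auto
  have L: "L 0 \<le> L (- 1 / 2)" "L (1 / 2) \<le> L 0"
    unfolding L_def using assms(1) sg_bounds T[of 0] T[of "1 / 2"] by (auto intro!: lam_grid_le)
  have "0 \<le> (1 - al) * (real s + sg) powr (- al)"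
    using al by simp
  also have "\<dots> \<le> a - b"
    unfolding a_def b_def using al sg_bounds assms(1) by (intro frac_a_minus_b_ge) auto
  finally have "0 \<le> a - b" .
  moreover have "0 \<le> b'"
    unfolding b'_def using al sg_bounds by (intro frac_b_nonneg) auto
  ultimately have "L (1 / 2) * (a - b + b') \<le> L 0 * (a - b + b')"
    using L by (intro mult_right_mono) auto
  moreover have "L 0 * a \<le> L (- 1 / 2) * a"
    using L frac_a_nonneg by (intro mult_right_mono) (auto simp: a_def)
  moreover have "frac_c al sg lam tau j s = L (- 1 / 2) * a + L 0 * b' - L 0 * b"
    using assms by (simp add: frac_c_def L_def a_def b_def b'_def algebra_simps)
  ultimately show ?thesis
    unfolding L_def[symmetric] a_def[symmetric] b_def[symmetric] b'_def[symmetric]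
    by (simp add: algebra_simps)
qed

lemma frac_c_le:
  assumes "1 \<le> s" "s \<le> j" "(real j + sg) * tau \<le> T"
  shows "frac_c al sg lam tau j s \<le> lam ((real s - 1 / 2 + sg) * tau) * frac_a al sg s"
proof -
  have T: "(real s + sg) * tau \<le> T"
    using assms by (intro grid_le_T[OF _ assms(3)]) auto
  have lam: "0 < lam ((real s + sg) * tau)"
    using sg_bounds T by (intro lam_grid_pos) auto
  have eq: "real r + sg - 1 / 2 = real r - 1 / 2 + sg" for r
    by simp
  show ?thesis
  proof (cases "s = j")
    case True
    have "0 \<le> lam ((real s + sg) * tau) * frac_b al sg s"
      using lam al sg_bounds assms by (simp add: frac_b_nonneg)
    then show ?thesis
      using assms True unfolding frac_c_def eq by simp
  next
    case False
    have "lam ((real s + sg) * tau) * frac_b al sg (Suc s) \<le> lam ((real s + sg) * tau) * frac_b al sg s"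
      using lam al sg_bounds assms by (simp add: frac_b_Suc_le)
    then show ?thesis
      using assms False unfolding frac_c_def eq by simp
  qed
qed

text \<open>Quantifies the decay of the weight of the oldest increment, which fixes the constant of
  the final estimate.\<close>

lemma frac_c_last_ge:
  assumes "(real j + sg) * tau \<le> T"
  shows "lam T * ((1 - al) * (real j + sg) powr (- al)) \<le> frac_c al sg lam tau j j"
proof -
  have lamT: "lam T \<le> lam ((real j + sg) * tau)"
    using assms sg_bounds tau by (intro lam_antimono) auto
  have pos: "0 < lam ((real j + sg) * tau)"
    using assms sg_bounds by (intro lam_grid_pos) auto
  have half: "lam ((real j + sg) * tau) \<le> lam ((real j + sg - 1 / 2) * tau)"
    using assms sg_bounds by (intro lam_grid_le) auto
  \<comment> \<open>Level 0 has no b-term; there the bound reduces to 1 - \<alpha> <=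
    \<sigma>.\<close>
  have le: "(1 - al) * (real j + sg) powr (- al) \<le> frac_a al sg j - (if j = 0 then 0 else frac_b al sg j)"
  proof (cases "j = 0")
    case True
    have "(1 - al) * sg powr (- al) \<le> sg * sg powr (- al)"
      using sg_bounds by (intro mult_right_mono) auto
    also have "\<dots> = sg powr (1 - al)"
      using sg_bounds by (simp add: powr_mult_base)
    finally show ?thesis
      using True by (simp add: frac_a_def)
  next
    case False
    then show ?thesis
      using frac_a_minus_b_ge[of al sg j] al sg_bounds by simp
  qed
  have "lam T * ((1 - al) * (real j + sg) powr (- al))
      \<le> lam ((real j + sg) * tau) * ((1 - al) * (real j + sg) powr (- al))"
    using lamT al by (intro mult_right_mono) auto
  also have "\<dots> \<le> lam ((real j + sg) * tau) * (frac_a al sg j - (if j = 0 then 0 else frac_b al sg j))"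
    using pos le by (intro mult_left_mono) auto
  also have "\<dots> \<le> lam ((real j + sg - 1 / 2) * tau) * frac_a al sg j
      - lam ((real j + sg) * tau) * (if j = 0 then 0 else frac_b al sg j)"
    using mult_right_mono[OF half frac_a_nonneg[of j]] by (simp add: right_diff_distrib)
  also have "\<dots> = frac_c al sg lam tau j j"
    by (simp add: frac_c_def)
  finally show ?thesis .
qed

text \<open>Stronger than monotonicity, since 1 - \<alpha> = 2\<sigma> - 1 < \<sigma>; the square
  inequality needs it for its last two terms. A common sample of \<lambda> reduces it to
  \<open>frac_a_1_le\<close>.\<close>

lemma frac_c_1_le:
  assumes "1 \<le> j" "(real j + sg) * tau \<le> T"
  shows "sg * frac_c al sg lam tau j 1 \<le> (1 - al) * frac_c al sg lam tau j 0"
proof -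
  define L where "L = lam ((1 / 2 + sg) * tau)"
  have "(1 / 2 + sg) * tau \<le> T"
    using assms by (intro grid_le_T[OF _ assms(2)]) auto
  then have L: "0 < L"
    unfolding L_def using sg_bounds by (intro lam_grid_pos) auto
  have "sg * frac_c al sg lam tau j 1 \<le> sg * (L * frac_a al sg 1)"
    using frac_c_le[of 1 j] assms sg_bounds by (intro mult_left_mono) (auto simp: L_def)
  also have "\<dots> = L * (sg * frac_a al sg 1)"
    by simp
  also have "\<dots> \<le> L * ((1 - al) * (frac_a al sg 0 + frac_b al sg 1))"
    using L al by (intro mult_left_mono frac_a_1_le sg) auto
  also have "\<dots> = (1 - al) * (L * (frac_a al sg 0 + frac_b al sg 1))"
    by simp
  also have "\<dots> \<le> (1 - al) * frac_c al sg lam tau j 0"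
    unfolding L_def using assms al by (intro mult_left_mono frac_c_0_ge) auto
  finally show ?thesis .
qed

lemma frac_c_last_pos:
  assumes "(real j + sg) * tau \<le> T"
  shows "0 < frac_c al sg lam tau j j"
proof -
  have "0 \<le> (real j + sg) * tau"
    using sg_bounds tau by simp
  with assms have "0 < lam T"
    by (intro lam_pos) auto
  then have "0 < lam T * ((1 - al) * (real j + sg) powr (- al))"
    using al sg_bounds by simp
  with frac_c_last_ge[OF assms] show ?thesis
    by linarith
qed

lemma frac_c_0_pos:
  assumes "(real j + sg) * tau \<le> T"
  shows "0 < frac_c al sg lam tau j 0"
proof (cases "j = 0")
  case True
  with frac_c_last_pos[OF assms] show ?thesis
    by simp
next
  case False
  then have "(1 / 2 + sg) * tau \<le> T"
    by (intro grid_le_T[OF _ assms]) auto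
  then have "0 < lam ((1 / 2 + sg) * tau)"
    using sg_bounds by (intro lam_grid_pos) auto
  moreover have "0 < frac_a al sg 0 + frac_b al sg 1"
    using al sg_bounds frac_b_nonneg[of al sg 1] by (simp add: frac_a_def add_pos_nonneg)
  ultimately have "0 < lam ((1 / 2 + sg) * tau) * (frac_a al sg 0 + frac_b al sg 1)"
    by simp
  with False frac_c_0_ge[of j] assms show ?thesis
    by simp
qed

text \<open>For s = 0 this weakens \<open>frac_c_1_le\<close>. Otherwise \<open>L\<close> times
  a_(s+1) and \<open>L\<close> times a_s - b_s + b_(s+1) lie between the two sides, ordered by the
  monotonicity of a_l - b_l.\<close>

lemma frac_c_Suc_le:
  assumes "s < j" "(real j + sg) * tau \<le> T"
  shows "frac_c al sg lam tau j (Suc s) \<le> frac_c al sg lam tau j s"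
proof (cases "s = 0")
  case True
  have "sg * frac_c al sg lam tau j 1 \<le> (1 - al) * frac_c al sg lam tau j 0"
    using assms by (intro frac_c_1_le) auto
  also have "\<dots> \<le> sg * frac_c al sg lam tau j 0"
    using assms sg_bounds by (intro mult_right_mono less_imp_le[OF frac_c_0_pos]) auto
  finally show ?thesis
    using sg_bounds True by simp
next
  case False
  define L where "L = lam ((real s + 1 / 2 + sg) * tau)"
  have "(real s + 1 / 2 + sg) * tau \<le> T"
    using assms by (intro grid_le_T[OF _ assms(2)]) auto
  then have L: "0 < L"
    unfolding L_def using sg_bounds by (intro lam_grid_pos) auto
  have "real (Suc s) - 1 / 2 + sg = real s + 1 / 2 + sg"
    by simp
  then have "frac_c al sg lam tau j (Suc s) \<le> L * frac_a al sg (Suc s)"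
    using frac_c_le[of "Suc s" j] assms by (simp only: L_def)
  also have "\<dots> \<le> L * (frac_a al sg s - frac_b al sg s + frac_b al sg (s + 1))"
    using L False al sg_bounds frac_a_minus_b_Suc_le[of al sg s] by (intro mult_left_mono) auto
  also have "\<dots> \<le> frac_c al sg lam tau j s"
    unfolding L_def using assms False by (intro frac_c_ge) auto
  finally show ?thesis .
qed

end

section \<open>Energy and comparison estimates\<close>

text \<open>Abel summation with the nonnegative interior terms dropped. \<open>E (Suc n)\<close> may
  have either sign: in the comparison argument it is the quantity to be bounded.\<close>

lemma weighted_sum_diff_ge:
  fixes g E :: "nat \<Rightarrow> real"
  assumes "\<And>s. s < n \<Longrightarrow> g s \<le> g (Suc s)" "\<And>s. s \<le> n \<Longrightarrow> E s \<ge> 0"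
  shows "g 0 * E 0 - g n * E (Suc n) \<le> (\<Sum>s=0..n. g s * (E s - E (Suc s)))"
  using assms
proof (induction n)
  case (Suc n)
  have "g n * E (Suc n) \<le> g (Suc n) * E (Suc n)"
    using Suc.prems by (intro mult_right_mono) auto
  moreover have "g 0 * E 0 - g n * E (Suc n) \<le> (\<Sum>s=0..n. g s * (E s - E (Suc s)))"
    using Suc.prems by (intro Suc.IH) auto
  ultimately show ?case by (simp add: algebra_simps)
qed (simp add: algebra_simps)

context nonincreasing_kernel
begin

text \<open>Termwise, \<open>2 * w * (v (s + 1) - v s) - ((v (s + 1))\<^sup>2 - (v s)\<^sup>2)\<close> is the decrement of
  \<open>(w - v s)\<^sup>2\<close>, and only the last decrement can contribute negatively to the weighted sum.\<close>

lemma frac_deriv_square_le: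
  assumes "(real j + sg) * tau \<le> T"
  shows "frac_deriv al sg lam tau j (\<lambda>s. (v s)\<^sup>2)
    \<le> 2 * (sg * v (j + 1) + (1 - sg) * v j) * frac_deriv al sg lam tau j v"
proof -
  define w where "w = sg * v (j + 1) + (1 - sg) * v j"
  define c where "c = frac_c al sg lam tau j"
  define E where "E s = (w - v s)\<^sup>2" for s
  define d where "d = v (j + 1) - v j"
  \<comment> \<open>\<open>w\<close> divides the last jump \<open>d\<close> in the ratio \<sigma> :
    1 - \<sigma>, so the last decrement of \<open>E\<close> is (2\<sigma> - 1) d^2.\<close>
  have "w - v j = sg * d" "w - v (Suc j) = - ((1 - sg) * d)"
    by (simp_all add: w_def d_def algebra_simps)
  then have Ej: "E j = sg\<^sup>2 * d\<^sup>2" "E (Suc j) = (1 - sg)\<^sup>2 * d\<^sup>2"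
    by (simp_all only: E_def power_mult_distrib power2_minus)
  have c0: "0 \<le> c 0"
    unfolding c_def by (rule less_imp_le[OF frac_c_0_pos[OF assms]])
  have last: "c 0 * (E j - E (Suc j)) = (2 * sg - 1) * c 0 * d\<^sup>2"
    unfolding Ej by (simp add: power2_eq_square algebra_simps)
  have last_nonneg: "0 \<le> c 0 * (E j - E (Suc j))"
    unfolding last using c0 sg_bounds by (intro mult_nonneg_nonneg) auto
  have nonneg: "0 \<le> (\<Sum>s=0..j. c (j - s) * (E s - E (Suc s)))"
  proof (cases j)
    case 0
    then show ?thesis
      using last_nonneg by simp
  next
    case (Suc n)
    \<comment> \<open>The last term is kept out of the summation by parts: it has to pay for the
      boundary term \<open>c 1 * E j\<close> left behind, and \<open>frac_c_1_le\<close> says that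
      it can.\<close>
    have "c (j - 0) * E 0 - c (j - n) * E (Suc n) \<le> (\<Sum>s=0..n. c (j - s) * (E s - E (Suc s)))"
    proof (rule weighted_sum_diff_ge)
      fix s assume "s < n"
      then have "j - s = Suc (j - Suc s)" "j - Suc s < j"
        using Suc by auto
      then show "c (j - s) \<le> c (j - Suc s)"
        using frac_c_Suc_le assms by (simp add: c_def)
    qed (simp add: E_def)
    moreover have "0 \<le> c (j - 0) * E 0"
      using frac_c_last_pos[OF assms] by (simp add: c_def E_def)
    moreover have "c (j - n) * E (Suc n) \<le> (2 * sg - 1) * c 0 * d\<^sup>2"
    proof -
      have "sg * (sg * c 1) \<le> sg * ((2 * sg - 1) * c 0)"
        using frac_c_1_le[of j] assms Suc sg_bounds unfolding c_def sg_bounds(5)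
        by (intro mult_left_mono) auto
      also have "\<dots> \<le> 1 * ((2 * sg - 1) * c 0)"
        using sg_bounds c0 by (intro mult_right_mono) auto
      finally have "sg * (sg * c 1) * d\<^sup>2 \<le> (2 * sg - 1) * c 0 * d\<^sup>2"
        by (intro mult_right_mono) auto
      then show ?thesis
        using Suc Ej by (simp add: power2_eq_square mult_ac)
    qed
    moreover have "(\<Sum>s=0..j. c (j - s) * (E s - E (Suc s)))
        = (\<Sum>s=0..n. c (j - s) * (E s - E (Suc s))) + c 0 * (E j - E (Suc j))"
      using Suc by simp
    ultimately show ?thesis
      unfolding last by linarith
  qed
  have "2 * w * (c (j - s) * ((v (s + 1) - v s) / tau)) - c (j - s) * (((v (s + 1))\<^sup>2 - (v s)\<^sup>2) / tau)
      = c (j - s) * (E s - E (Suc s)) / tau" for s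
  proof -
    have "E s - E (Suc s) = 2 * w * (v (s + 1) - v s) - ((v (s + 1))\<^sup>2 - (v s)\<^sup>2)"
      by (simp add: E_def power2_eq_square algebra_simps)
    then show ?thesis
      by (simp add: diff_divide_distrib right_diff_distrib mult_ac)
  qed
  then have "2 * w * (\<Sum>s=0..j. c (j - s) * ((v (s + 1) - v s) / tau))
        - (\<Sum>s=0..j. c (j - s) * (((v (s + 1))\<^sup>2 - (v s)\<^sup>2) / tau))
      = (\<Sum>s=0..j. c (j - s) * (E s - E (Suc s))) / tau"
    by (simp only: sum_distrib_left sum_divide_distrib flip: sum_subtractf)
  also have "\<dots> \<ge> 0"
    using nonneg tau by simp
  finally have "(\<Sum>s=0..j. c (j - s) * (((v (s + 1))\<^sup>2 - (v s)\<^sup>2) / tau))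
      \<le> 2 * w * (\<Sum>s=0..j. c (j - s) * ((v (s + 1) - v s) / tau))"
    by simp
  then have "tau powr (1 - al) / Gamma (2 - al) * (\<Sum>s=0..j. c (j - s) * (((v (s + 1))\<^sup>2 - (v s)\<^sup>2) / tau))
      \<le> tau powr (1 - al) / Gamma (2 - al) * (2 * w * (\<Sum>s=0..j. c (j - s) * ((v (s + 1) - v s) / tau)))"
    using al by (intro mult_left_mono) (auto intro!: divide_nonneg_nonneg less_imp_le[OF Gamma_real_pos])
  then show ?thesis
    unfolding frac_deriv_def c_def[symmetric] w_def[symmetric] by (simp only: mult_ac)
qed

text \<open>A discrete comparison principle with memory: in terms of the gap \<open>E\<close> to the
  bound, \<open>R\<close> is absorbed by the weight of the oldest increment, and Abel summation
  leaves \<open>0 \<le> c 0 * E (Suc j)\<close>.\<close>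

lemma frac_deriv_comparison:
  assumes jT: "(real j + sg) * tau \<le> T"
    and Y: "\<And>s. s \<le> j \<Longrightarrow> Y s \<le> Y 0 + X"
    and deriv: "frac_deriv al sg lam tau j Y \<le> R"
    and R: "tau powr al * Gamma (2 - al) * R \<le> frac_c al sg lam tau j j * X"
  shows "Y (j + 1) \<le> Y 0 + X"
proof -
  define c where "c = frac_c al sg lam tau j"
  define E where "E s = Y 0 + X - Y s" for s
  have G: "0 < Gamma (2 - al)"
    using al by (intro Gamma_real_pos) auto
  have "frac_deriv al sg lam tau j Y
      = tau powr (1 - al) / tau / Gamma (2 - al) * (\<Sum>s=0..j. c (j - s) * (Y (s + 1) - Y s))"
    by (simp add: frac_deriv_def c_def sum_divide_distrib[symmetric])
  also have "tau powr (1 - al) / tau = 1 / tau powr al"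
    using tau by (simp add: powr_diff)
  finally have "(\<Sum>s=0..j. c (j - s) * (Y (s + 1) - Y s)) / (tau powr al * Gamma (2 - al)) \<le> R"
    using deriv by simp
  then have "(\<Sum>s=0..j. c (j - s) * (Y (s + 1) - Y s)) \<le> tau powr al * Gamma (2 - al) * R"
    using tau G by (simp add: pos_divide_le_eq mult.commute)
  also have "\<dots> \<le> c (j - 0) * E 0"
    using R by (simp add: c_def E_def)
  finally have "(\<Sum>s=0..j. c (j - s) * (E s - E (Suc s))) \<le> c (j - 0) * E 0"
    by (simp add: E_def)
  moreover have "c (j - 0) * E 0 - c (j - j) * E (Suc j) \<le> (\<Sum>s=0..j. c (j - s) * (E s - E (Suc s)))"
  proof (rule weighted_sum_diff_ge)
    fix s assume "s < j"
    then have "j - s = Suc (j - Suc s)" "j - Suc s < j"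
      by auto
    then show "c (j - s) \<le> c (j - Suc s)"
      using frac_c_Suc_le jT by (simp add: c_def)
  qed (simp add: E_def Y)
  ultimately have "0 \<le> c 0 * E (Suc j)"
    by simp
  then have "0 \<le> E (Suc j)"
    using frac_c_0_pos[OF jT] by (simp add: c_def zero_le_mult_iff)
  then show ?thesis
    by (simp add: E_def)
qed

end

section \<open>The spatial operator and the a priori estimate\<close>

text \<open>Discrete Green formula with \<open>n\<close> interior nodes and \<open>n + 1\<close>
  cells.\<close>

lemma sum_by_parts:
  fixes w P :: "nat \<Rightarrow> real"
  shows "(\<Sum>i<n. w (Suc i) * (P (Suc (Suc i)) - P (Suc i)))
    = w (Suc n) * P (Suc n) - w 0 * P 1 - (\<Sum>i<Suc n. (w (Suc i) - w i) * P (Suc i))"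
  by (induction n) (simp_all add: algebra_simps)

text \<open>Telescoping from the left end and Cauchy-Schwarz bound each squared value by N times the
  sum of squared differences. Constant 1 suffices to make the coercivity constant equal to
  \<open>c1\<close>.\<close>

lemma discrete_poincare:
  fixes w :: "nat \<Rightarrow> real"
  assumes "w 0 = 0" "0 < N"
  shows "norm0_sq N (1 / real N) w \<le> (\<Sum>i<N. (w (Suc i) - w i)\<^sup>2) / (1 / real N)"
proof -
  define S where "S = (\<Sum>i<N. (w (Suc i) - w i)\<^sup>2)"
  have S: "0 \<le> S"
    by (simp add: S_def sum_nonneg)
  have "(w i)\<^sup>2 \<le> real N * S" if "i \<le> N" for i
  proof -
    have "w i = (\<Sum>r<i. w (Suc r) - w r)"
      using assms(1) by (simp add: sum_lessThan_telescope)
    then have "(w i)\<^sup>2 \<le> (\<Sum>r<i. (w (Suc r) - w r)\<^sup>2) * real i"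
      using sum_squared_le_sum_of_squares[of "\<lambda>r. w (Suc r) - w r" "{..<i}"]
      by (simp add: mult.commute)
    also have "\<dots> \<le> S * real N"
      unfolding S_def using that by (intro mult_mono sum_mono2 sum_nonneg) auto
    finally show ?thesis
      by (simp add: mult.commute)
  qed
  then have "norm0_sq N (1 / real N) w \<le> (\<Sum>i=1..N-1. real N * S * (1 / real N))"
    unfolding norm0_sq_def by (intro sum_mono mult_right_mono) auto
  also have "\<dots> = real (N - 1) * S"
    using assms(2) by simp
  also have "\<dots> \<le> real N * S"
    using S by (intro mult_right_mono) auto
  finally show ?thesis
    by (simp add: S_def mult.commute)
qed

text \<open>Summation by parts turns the operator into the energy of the differences; the q-term has
  a favourable sign, k >= c1 at the midpoints, and the Poincare inequality concludes.\<close>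

lemma space_op_coercive:
  fixes w :: "nat \<Rightarrow> real"
  assumes "0 < N" "h = 1 / real N" "w 0 = 0" "w N = 0"
    and k: "\<And>x. x \<in> {0..1} \<Longrightarrow> c1 \<le> k x t" and q: "\<And>x. x \<in> {0..1} \<Longrightarrow> 0 \<le> q x t"
    and "0 \<le> c1"
  shows "(\<Sum>i=1..N-1. w i * space_op k q h t w i * h) \<le> - c1 * norm0_sq N h w"
proof -
  have h: "0 < h" "real N * h = 1"
    using assms by auto
  have grid: "real i * h \<le> 1" if "i \<le> N" for i
    using that h mult_right_mono[of "real i" "real N" h] by simp
  define a where "a i = k (real i * h - h / 2) t" for i
  \<comment> \<open>Up to the factor \<open>h\<close>, \<open>P i\<close> is the flux through the
    midpoint of the cell ending at node \<open>i\<close>.\<close>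
  define P where "P i = a i * (w i - w (i - 1))" for i
  have "w i * space_op k q h t w i * h \<le> w i * (P (Suc i) - P i) / h" if "i \<in> {1..N-1}" for i
  proof -
    have S: "space_op k q h t w i = (P (Suc i) - P i) / h\<^sup>2 - q (real i * h) t * w i"
      unfolding space_op_def Let_def P_def a_def by (simp add: algebra_simps)
    have "w i * space_op k q h t w i * h
        = w i * (P (Suc i) - P i) / h - q (real i * h) t * (w i)\<^sup>2 * h"
      using h by (simp add: S power2_eq_square field_simps)
    moreover have "0 \<le> q (real i * h) t * (w i)\<^sup>2 * h"
      using that h grid[of i] by (intro mult_nonneg_nonneg q) auto
    ultimately show ?thesis
      by simp
  qed
  then have "(\<Sum>i=1..N-1. w i * space_op k q h t w i * h) \<le> (\<Sum>i=1..N-1. w i * (P (Suc i) - P i) / h)"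
    by (rule sum_mono)
  also have "\<dots> = (\<Sum>i<N-1. w (Suc i) * (P (Suc (Suc i)) - P (Suc i))) / h"
    by (simp add: sum.atLeast1_atMost_eq sum_divide_distrib)
  also have "\<dots> = - (\<Sum>i<N. (w (Suc i) - w i) * P (Suc i)) / h"
    using assms(1,3,4) sum_by_parts[of w P "N - 1"] by simp
  also have "\<dots> \<le> - (\<Sum>i<N. c1 * (w (Suc i) - w i)\<^sup>2) / h"
  proof -
    have "c1 * (w (Suc i) - w i)\<^sup>2 \<le> (w (Suc i) - w i) * P (Suc i)" if "i < N" for i
    proof -
      have "c1 \<le> a (Suc i)"
        unfolding a_def using that h grid[of "Suc i"]
        by (intro k) (auto simp: distrib_right)
      then show ?thesis
        using mult_right_mono[of c1 "a (Suc i)" "(w (Suc i) - w i)\<^sup>2"]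
        by (simp add: P_def power2_eq_square mult_ac)
    qed
    then have "(\<Sum>i<N. c1 * (w (Suc i) - w i)\<^sup>2) \<le> (\<Sum>i<N. (w (Suc i) - w i) * P (Suc i))"
      by (intro sum_mono) auto
    then show ?thesis
      using h by (intro divide_right_mono) auto
  qed
  also have "\<dots> = - c1 * ((\<Sum>i<N. (w (Suc i) - w i)\<^sup>2) / h)"
    by (simp flip: sum_distrib_left)
  also have "\<dots> \<le> - c1 * norm0_sq N h w"
    using discrete_poincare[of w N] assms by (intro mult_left_mono_neg) auto
  finally show ?thesis .
qed

section \<open>Energy inequality at one time level\<close>

lemma frac_deriv_norm0_sq:
  "frac_deriv al sg lam tau j (\<lambda>s. norm0_sq N h (y s))
    = (\<Sum>i=1..N-1. frac_deriv al sg lam tau j (\<lambda>s. (y s i)\<^sup>2) * h)"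
proof -
  have "frac_c al sg lam tau j (j - s) * ((norm0_sq N h (y (s + 1)) - norm0_sq N h (y s)) / tau)
      = (\<Sum>i=1..N-1. frac_c al sg lam tau j (j - s) * (((y (s + 1) i)\<^sup>2 - (y s i)\<^sup>2) / tau) * h)" for s
    unfolding norm0_sq_def sum_subtractf[symmetric] sum_divide_distrib sum_distrib_left
    by (intro sum.cong refl) (simp flip: left_diff_distrib)
  then show ?thesis
    unfolding frac_deriv_def
    by (simp add: sum_distrib_left sum_distrib_right mult_ac, subst sum.swap, simp add: mult_ac)
qed

lemma (in nonincreasing_kernel) frac_deriv_energy_le:
  fixes y :: "nat \<Rightarrow> nat \<Rightarrow> real"
  assumes jT: "(real j + sg) * tau \<le> T" and "0 < N" "h = 1 / real N" "0 < c1"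
    and k: "\<And>x t. x \<in> {0..1} \<Longrightarrow> t \<in> {0..T} \<Longrightarrow> c1 \<le> k x t"
    and q: "\<And>x t. x \<in> {0..1} \<Longrightarrow> t \<in> {0..T} \<Longrightarrow> 0 \<le> q x t"
    and bc: "\<And>s. s \<in> {j, j + 1} \<Longrightarrow> y s 0 = 0 \<and> y s N = 0"
    and scheme: "\<And>i. i \<in> {1..N-1} \<Longrightarrow> frac_deriv al sg lam tau j (\<lambda>s. y s i)
        = space_op k q h ((real j + sg) * tau) (shifted sg y j) i + F i"
  shows "frac_deriv al sg lam tau j (\<lambda>s. norm0_sq N h (y s)) \<le> norm0_sq N h F / (2 * c1)"
proof -
  let ?t = "(real j + sg) * tau"
  define w where "w = shifted sg y j"
  have h: "0 < h"
    using assms by simp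
  have t: "?t \<in> {0..T}"
    using jT sg_bounds tau by simp
  \<comment> \<open>The weight \<open>2 * c1\<close> makes the quadratic term cancel exactly against
    twice the coercivity bound.\<close>
  have young: "2 * x * z \<le> 2 * c1 * x\<^sup>2 + z\<^sup>2 / (2 * c1)" for x z
  proof -
    have "0 \<le> (2 * c1 * x - z)\<^sup>2 / (2 * c1)"
      using \<open>0 < c1\<close> by simp
    also have "\<dots> = 2 * c1 * x\<^sup>2 - 2 * x * z + z\<^sup>2 / (2 * c1)"
      using \<open>0 < c1\<close> by (simp add: power2_eq_square field_simps)
    finally show ?thesis
      by simp
  qed
  have "frac_deriv al sg lam tau j (\<lambda>s. (y s i)\<^sup>2) * h
      \<le> 2 * (w i * space_op k q h ?t w i * h) + (2 * c1 * ((w i)\<^sup>2 * h) + (F i)\<^sup>2 * h / (2 * c1))"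
    if i: "i \<in> {1..N-1}" for i
  proof -
    have "frac_deriv al sg lam tau j (\<lambda>s. (y s i)\<^sup>2) \<le> 2 * w i * (space_op k q h ?t w i + F i)"
      using frac_deriv_square_le[OF jT, of "\<lambda>s. y s i"] scheme[OF i] by (simp add: w_def shifted_def)
    also have "\<dots> \<le> 2 * w i * space_op k q h ?t w i + (2 * c1 * (w i)\<^sup>2 + (F i)\<^sup>2 / (2 * c1))"
      using young[of "w i" "F i"] by (simp add: distrib_left)
    finally have "frac_deriv al sg lam tau j (\<lambda>s. (y s i)\<^sup>2) * h \<le> \<dots> * h"
      using h by (intro mult_right_mono) auto
    then show ?thesis
      by (simp only: distrib_right mult.assoc times_divide_eq_left)
  qed
  then have "frac_deriv al sg lam tau j (\<lambda>s. norm0_sq N h (y s))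
      \<le> (\<Sum>i=1..N-1. 2 * (w i * space_op k q h ?t w i * h)
          + (2 * c1 * ((w i)\<^sup>2 * h) + (F i)\<^sup>2 * h / (2 * c1)))"
    unfolding frac_deriv_norm0_sq by (rule sum_mono)
  also have "\<dots> = 2 * (\<Sum>i=1..N-1. w i * space_op k q h ?t w i * h)
      + (2 * c1 * norm0_sq N h w + norm0_sq N h F / (2 * c1))"
    by (simp only: norm0_sq_def sum.distrib sum_distrib_left sum_divide_distrib)
  also have "(\<Sum>i=1..N-1. w i * space_op k q h ?t w i * h) \<le> - c1 * norm0_sq N h w"
  proof (rule space_op_coercive[OF \<open>0 < N\<close> \<open>h = 1 / real N\<close>])
    show "w 0 = 0" "w N = 0"
      using bc by (simp_all add: w_def shifted_def)
  qed (use k q t \<open>0 < c1\<close> in auto)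
  finally show ?thesis
    by simp
qed

section \<open>The estimate on all time levels\<close>

text \<open>The mean value theorem for derivatives within an interval, which admits one-sided
  derivatives at the end points.\<close>

lemma antimono_of_nonpos_derivative_within:
  fixes f f' :: "real \<Rightarrow> real"
  assumes "\<And>t. t \<in> {a..b} \<Longrightarrow> (f has_real_derivative f' t) (at t within {a..b})"
    and "\<And>t. t \<in> {a..b} \<Longrightarrow> f' t \<le> 0"
    and "a \<le> s" "s \<le> t" "t \<le> b"
  shows "f t \<le> f s"
proof -
  have "\<exists>x\<in>{s..t}. f t - f s = (*) (f' x) (t - s)"
  proof (rule mvt_very_simple[OF \<open>s \<le> t\<close>])
    fix x assume "s \<le> x" "x \<le> t"
    with assms have "(f has_real_derivative f' x) (at x within {a..b})"
      by auto
    then show "(f has_derivative (*) (f' x)) (at x within {s..t})"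
      unfolding has_field_derivative_def
      by (rule has_derivative_subset) (use assms in auto)
  qed
  then obtain x where "x \<in> {s..t}" "f t - f s = f' x * (t - s)"
    by blast
  moreover have "f' x \<le> 0" if "x \<in> {s..t}"
    using that assms by auto
  ultimately show ?thesis
    using assms(4) mult_nonpos_nonneg[of "f' x" "t - s"] by simp
qed

theorem theorem4p1:
  fixes al sg T c1 c2 h tau :: real
    and lam lam' u0 :: "real \<Rightarrow> real"
    and k q f :: "real \<Rightarrow> real \<Rightarrow> real"
    and N M :: nat
    and y :: "nat \<Rightarrow> nat \<Rightarrow> real"
  assumes "0 < al" and "al < 1" and "sg = 1 - al / 2" and "T > 0"
    and "C2_on 0 T lam"
    and "\<And>t. t \<in> {0..T} \<Longrightarrow> lam t > 0"
    and "\<And>t. t \<in> {0..T} \<Longrightarrow> (lam has_real_derivative lam' t) (at t within {0..T})"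
    and "\<And>t. t \<in> {0..T} \<Longrightarrow> lam' t \<le> 0"
    and "0 < c1"
    and "\<And>x t. x \<in> {0..1} \<Longrightarrow> t \<in> {0..T} \<Longrightarrow> c1 \<le> k x t \<and> k x t \<le> c2"
    and "\<And>x t. x \<in> {0..1} \<Longrightarrow> t \<in> {0..T} \<Longrightarrow> q x t \<ge> 0"
    and "N \<ge> 2" and "M \<ge> 1"
    and "h = 1 / real N" and "tau = T / real M"
    and "solves_scheme al sg lam k q f u0 N M h tau y"
  shows "\<forall>j<M. norm0_sq N h (y (j + 1))
           \<le> norm0_sq N h (y 0)
             + T powr al * Gamma (1 - al) / (2 * lam T * c1)
               * (MAX m\<in>{..<M}. norm0_sq N h (source_grid f sg h tau m))"
proof -
  define F where "F = (MAX m\<in>{..<M}. norm0_sq N h (source_grid f sg h tau m))"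
  define X where "X = T powr al * Gamma (1 - al) / (2 * lam T * c1) * F"
  define Y where "Y s = norm0_sq N h (y s)" for s
  have tau_M: "0 < tau" "real M * tau = T"
    using assms(4,13,15) by auto
  interpret nonincreasing_kernel al sg T tau lam
    using assms(1-3,6) tau_M antimono_of_nonpos_derivative_within[of 0 T lam lam', OF assms(7,8)]
    by unfold_locales auto
  have lamT: "0 < lam T"
    using assms(4) by (intro lam_pos) auto
  have G: "0 < Gamma (1 - al)" "Gamma (2 - al) = (1 - al) * Gamma (1 - al)"
  proof -
    show "0 < Gamma (1 - al)"
      using al by (intro Gamma_real_pos) auto
    have "1 - al \<notin> \<int>\<^sub>\<le>\<^sub>0"
      using al by (auto dest: nonpos_Ints_nonpos)
    from Gamma_plus1[OF this] show "Gamma (2 - al) = (1 - al) * Gamma (1 - al)"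
      by (simp add: algebra_simps)
  qed
  have F_ge: "norm0_sq N h (source_grid f sg h tau m) \<le> F" if "m < M" for m
    unfolding F_def using that by (intro Max_ge) auto
  have F: "0 \<le> F"
  proof -
    have "0 \<le> norm0_sq N h (source_grid f sg h tau 0)"
      using assms(14) by (auto simp: norm0_sq_def intro!: sum_nonneg)
    also have "\<dots> \<le> F"
      using assms(13) by (intro F_ge) auto
    finally show ?thesis .
  qed
  have X: "0 \<le> X"
    using F G lamT assms(9) by (auto simp: X_def)
  \<comment> \<open>Strong induction, because the fractional derivative involves all earlier levels;
    \<open>X\<close> is the same on each, so errors do not accumulate.\<close>
  have "Y s \<le> Y 0 + X" if "s \<le> M" for s
    using that
  proof (induction s rule: less_induct)
    case (less s)
    show ?case
    proof (cases s)
      case 0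
      then show ?thesis using X by simp
    next
      case (Suc j)
      then have j: "j < M"
        using less.prems by simp
      \<comment> \<open>As \<sigma> < 1, the evaluation time stays within [0, T] at every level
        below \<open>M\<close>.\<close>
      have "real j + sg \<le> real M"
        using j sg_bounds by linarith
      then have jT: "(real j + sg) * tau \<le> T"
        using mult_right_mono[of "real j + sg" "real M" tau] tau_M by simp
      have "Y (j + 1) \<le> Y 0 + X"
      proof (rule frac_deriv_comparison[OF jT])
        show "Y r \<le> Y 0 + X" if "r \<le> j" for r
          using less that Suc by simp
        have "frac_deriv al sg lam tau j Y \<le> norm0_sq N h (source_grid f sg h tau j) / (2 * c1)"
          unfolding Y_def
        proof (rule frac_deriv_energy_le[OF jT])
          show "y s 0 = 0 \<and> y s N = 0" if "s \<in> {j, j + 1}" for s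
            using that j assms(16) by (auto simp: solves_scheme_def)
          show "frac_deriv al sg lam tau j (\<lambda>s. y s i)
              = space_op k q h ((real j + sg) * tau) (shifted sg y j) i + source_grid f sg h tau j i"
            if "i \<in> {1..N-1}" for i
            using that j assms(16) unfolding solves_scheme_def by blast
        qed (use assms in auto)
        also have "\<dots> \<le> F / (2 * c1)"
          using F_ge[OF j] assms(9) by (intro divide_right_mono) auto
        finally show "frac_deriv al sg lam tau j Y \<le> F / (2 * c1)" .
        have pos: "0 < real j + sg"
          using sg_bounds by simp
        \<comment> \<open>From \<open>(real j + sg) * tau \<le> T\<close>: the power of
          \<open>tau\<close> is traded for T^\<alpha> times exactly the decay in the lower bound for
          c_j, so the constant depends on neither the level nor the meshes.\<close>
        have "(real j + sg) powr al * tau powr al \<le> T powr al"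
          using powr_mono2[of al "(real j + sg) * tau" T] jT pos tau al
          by (simp add: powr_mult)
        then have "tau powr al \<le> T powr al * (real j + sg) powr (- al)"
          using pos by (simp add: powr_minus field_simps)
        then have "tau powr al * (Gamma (2 - al) * (F / (2 * c1)))
            \<le> T powr al * (real j + sg) powr (- al) * (Gamma (2 - al) * (F / (2 * c1)))"
          using F G al assms(9) by (intro mult_right_mono) auto
        \<comment> \<open>The factor 1 - \<alpha> of that lower bound turns \<Gamma>(1 - \<alpha>)
          in \<open>X\<close> into \<Gamma>(2 - \<alpha>).\<close>
        also have "\<dots> = lam T * ((1 - al) * (real j + sg) powr (- al)) * X"
          using lamT assms(9) by (simp add: X_def G(2) field_simps)
        also have "\<dots> \<le> frac_c al sg lam tau j j * X"
          by (intro mult_right_mono frac_c_last_ge jT X)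
        finally show "tau powr al * Gamma (2 - al) * (F / (2 * c1)) \<le> frac_c al sg lam tau j j * X"
          by (simp add: mult.assoc)
      qed
      then show ?thesis
        using Suc by simp
    qed
  qed
  then show ?thesis
    unfolding Y_def X_def F_def by simp
qed

end
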